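(* Let $\mathbf r(s)=(x(s),y(s),z(s))$, $s\in I$, be a smooth horizontally regular curve in $\mathbb H_1$ parametrized by horizontal arc length, with contact normality $\tau$, and assume that $\mathbf r$ has nonzero constant $p$-curvature $\kappa=\kappa_0$. Let $R(s)=\sqrt{x(s)^2+y(s)^2}$ and $Z(s)=z(s)$. Then there are constants $C_1,C_2,C_3,C_4$ such that $$\begin{aligned}R(s)^2&=\frac1{\kappa_0}\bigl(-C_1\cos(\kappa_0s)+C_2\sin(\kappa_0s)+C_3\bigr),\\ Z(s)&=\int_{s_0}^s\tau(t)\,dt+\frac{C_1}{2\kappa_0}\sin(\kappa_0s)+\frac{C_2}{2\kappa_0}\cos(\kappa_0s)-\frac{s}{\kappa_0}+C_4 .\end{aligned}$$ The constants satisfy the compatibility condition $$C_3=\frac1{\kappa_0}+\frac{\kappa_0}{4}\bigl(C_1^2+C_2^2\bigr),$$ and there is no further algebraic compatibility condition among $C_1$, $C_2$, and $C_4$. Under this condition, the right-hand side of the formula for $R(s)^2$ is automatically nonnegative.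
   Context: The Heisenberg group $\mathbb H_1$ is identified with $\mathbb R^3$ through its standard coordinates $(x,y,z)$. $I\subset\mathbb R$ is the parameter interval of the curve and $s_0\in I$ is a fixed point. A smooth curve $\mathbf r=(x,y,z)$ is horizontally regular if $(x')^2+(y')^2\neq0$ everywhere, and parametrized by horizontal arc length if $(x')^2+(y')^2\equiv1$. For such a parametrization the $p$-curvature is $\kappa=x'y''-x''y'$ and the contact normality is $\tau=xy'-x'y+z'$. *)

theory Defs
  imports "HOL-Analysis.Analysis"
begin

(* The parameter interval may contain endpoints, so all derivatives are taken
   relative to I (one-sided at an endpoint of I); in the interior they are the
   ordinary derivatives. *)
definition deriv_on :: "real set \<Rightarrow> (real \<Rightarrow> 'a::real_normed_vector) \<Rightarrow> real \<Rightarrow> 'a" where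
  "deriv_on I f s = vector_derivative f (at s within I)"

definition smooth_on :: "real set \<Rightarrow> (real \<Rightarrow> 'a::real_normed_vector) \<Rightarrow> bool" where
  "smooth_on I f \<longleftrightarrow> (\<forall>n. \<forall>s\<in>I. (deriv_on I ^^ n) f differentiable (at s within I))"

text \<open>The Heisenberg group in its standard coordinates \<open>(x, y, z)\<close>.\<close>

type_synonym heisenberg = "real ^ 3"

definition x_coord :: "(real \<Rightarrow> heisenberg) \<Rightarrow> real \<Rightarrow> real" where
  "x_coord r s = r s $ 1"

definition y_coord :: "(real \<Rightarrow> heisenberg) \<Rightarrow> real \<Rightarrow> real" where
  "y_coord r s = r s $ 2"

definition z_coord :: "(real \<Rightarrow> heisenberg) \<Rightarrow> real \<Rightarrow> real" where
  "z_coord r s = r s $ 3"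

definition horizontally_regular :: "real set \<Rightarrow> (real \<Rightarrow> heisenberg) \<Rightarrow> bool" where
  "horizontally_regular I r \<longleftrightarrow>
     (\<forall>s\<in>I. (deriv_on I (x_coord r) s)\<^sup>2 + (deriv_on I (y_coord r) s)\<^sup>2 \<noteq> 0)"

definition horizontal_arclength :: "real set \<Rightarrow> (real \<Rightarrow> heisenberg) \<Rightarrow> bool" where
  "horizontal_arclength I r \<longleftrightarrow>
     (\<forall>s\<in>I. (deriv_on I (x_coord r) s)\<^sup>2 + (deriv_on I (y_coord r) s)\<^sup>2 = 1)"

text \<open>The formulas below for the \<open>p\<close>-curvature and the contact normality are the ones
  valid for curves parametrized by horizontal arc length.\<close>

definition p_curvature :: "real set \<Rightarrow> (real \<Rightarrow> heisenberg) \<Rightarrow> real \<Rightarrow> real" where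
  "p_curvature I r s =
     deriv_on I (x_coord r) s * deriv_on I (deriv_on I (y_coord r)) s
     - deriv_on I (deriv_on I (x_coord r)) s * deriv_on I (y_coord r) s"

definition contact_normality :: "real set \<Rightarrow> (real \<Rightarrow> heisenberg) \<Rightarrow> real \<Rightarrow> real" where
  "contact_normality I r s =
     x_coord r s * deriv_on I (y_coord r) s - deriv_on I (x_coord r) s * y_coord r s
     + deriv_on I (z_coord r) s"

definition radius :: "(real \<Rightarrow> heisenberg) \<Rightarrow> real \<Rightarrow> real" where
  "radius r s = sqrt ((x_coord r s)\<^sup>2 + (y_coord r s)\<^sup>2)"

definition const_curvature_curve ::
    "real set \<Rightarrow> real \<Rightarrow> (real \<Rightarrow> real) \<Rightarrow> (real \<Rightarrow> heisenberg) \<Rightarrow> bool" where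
  "const_curvature_curve I \<kappa>\<^sub>0 \<tau> r \<longleftrightarrow>
     smooth_on I r \<and> horizontally_regular I r \<and> horizontal_arclength I r \<and>
     (\<forall>s\<in>I. contact_normality I r s = \<tau> s) \<and>
     (\<forall>s\<in>I. p_curvature I r s = \<kappa>\<^sub>0)"

definition radius_sq_formula :: "real \<Rightarrow> real \<Rightarrow> real \<Rightarrow> real \<Rightarrow> real \<Rightarrow> real" where
  "radius_sq_formula \<kappa>\<^sub>0 C1 C2 C3 s =
     1 / \<kappa>\<^sub>0 * (- C1 * cos (\<kappa>\<^sub>0 * s) + C2 * sin (\<kappa>\<^sub>0 * s) + C3)"

(* The interval integral is oriented: it changes sign when s < s0. *)
definition height_formula ::
    "real \<Rightarrow> real \<Rightarrow> (real \<Rightarrow> real) \<Rightarrow> real \<Rightarrow> real \<Rightarrow> real \<Rightarrow> real \<Rightarrow> real" where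
  "height_formula s\<^sub>0 \<kappa>\<^sub>0 \<tau> C1 C2 C4 s =
     (LBINT t=s\<^sub>0..s. \<tau> t) + C1 / (2 * \<kappa>\<^sub>0) * sin (\<kappa>\<^sub>0 * s)
     + C2 / (2 * \<kappa>\<^sub>0) * cos (\<kappa>\<^sub>0 * s) - s / \<kappa>\<^sub>0 + C4"

definition represented_by ::
    "real set \<Rightarrow> real \<Rightarrow> real \<Rightarrow> (real \<Rightarrow> real) \<Rightarrow> (real \<Rightarrow> heisenberg)
      \<Rightarrow> real \<Rightarrow> real \<Rightarrow> real \<Rightarrow> real \<Rightarrow> bool" where
  "represented_by I s\<^sub>0 \<kappa>\<^sub>0 \<tau> r C1 C2 C3 C4 \<longleftrightarrow>
     (\<forall>s\<in>I. (radius r s)\<^sup>2 = radius_sq_formula \<kappa>\<^sub>0 C1 C2 C3 s \<and>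
            z_coord r s = height_formula s\<^sub>0 \<kappa>\<^sub>0 \<tau> C1 C2 C4 s)"

definition compatible :: "real \<Rightarrow> real \<Rightarrow> real \<Rightarrow> real \<Rightarrow> bool" where
  "compatible \<kappa>\<^sub>0 C1 C2 C3 \<longleftrightarrow> C3 = 1 / \<kappa>\<^sub>0 + \<kappa>\<^sub>0 / 4 * (C1\<^sup>2 + C2\<^sup>2)"

end

theory Submission
  imports Defs
begin

text \<open>
  Differentiating the unit speed condition and combining with the definition of \<open>\<kappa>\<^sub>0\<close> gives
  \<open>x'' = - \<kappa>\<^sub>0 y'\<close> and \<open>y'' = \<kappa>\<^sub>0 x'\<close>. Hence \<open>a = x' + \<kappa>\<^sub>0 y\<close>, \<open>b = y' - \<kappa>\<^sub>0 x\<close> and the components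
  \<open>A, B\<close> of \<open>(x', y')\<close> in the frame rotating with angular speed \<open>\<kappa>\<^sub>0\<close> are constant, with
  \<open>A\<^sup>2 + B\<^sup>2 = 1\<close>. The formulas follow with \<open>C\<^sub>1 = 2 (a A + b B) / \<kappa>\<^sub>0\<close> and
  \<open>C\<^sub>2 = 2 (a B - b A) / \<kappa>\<^sub>0\<close>. The constants in the radius formula are unique because \<open>1, cos, sin\<close>
  are linearly independent on an interval. Conversely, the circle with centre
  \<open>(C\<^sub>2 / 2, C\<^sub>1 / 2)\<close> and radius \<open>1 / \<bar>\<kappa>\<^sub>0\<bar>\<close>, lifted by the height formula, realizes
  arbitrary \<open>C\<^sub>1, C\<^sub>2, C\<^sub>4\<close>.
\<close>

section \<open>Derivatives relative to a nondegenerate interval\<close>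

locale parameter_interval =
  fixes I :: "real set"
  assumes interval: "is_interval I" and interior_nonempty: "interior I \<noteq> {}"
begin

text \<open>A connected set with more than one point has no isolated points. This makes derivatives
  relative to \<open>I\<close> unique, endpoints included.\<close>

lemma at_within_nontrivial: "s \<in> I \<Longrightarrow> at s within I \<noteq> bot"
proof -
  assume s: "s \<in> I"
  have "\<not> (\<exists>a. I = {a})" using interior_nonempty by auto
  then have "s islimpt I"
    using s interval connected_imp_perfect is_interval_connected by blast
  then show ?thesis using trivial_limit_within by blast
qed

lemma deriv_on_eq:
  assumes "s \<in> I" "(f has_vector_derivative D) (at s within I)"
  shows "deriv_on I f s = D"
  unfolding deriv_on_def
  using assms at_within_nontrivial by (intro vector_derivative_within)

text \<open>Allows an identity known only on \<open>I\<close> to be differentiated on both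
  sides.\<close>

lemma has_real_derivative_unique:
  fixes f g :: "real \<Rightarrow> real"
  assumes "\<And>t. t \<in> I \<Longrightarrow> f t = g t" "s \<in> I"
    and "(f has_real_derivative D) (at s within I)" "(g has_real_derivative E) (at s within I)"
  shows "D = E"
proof -
  have "(g has_vector_derivative D) (at s within I)"
    using assms has_vector_derivative_transform[of s I g f D]
    by (auto simp: has_real_derivative_iff_has_vector_derivative)
  then show ?thesis
    using assms(2,4) deriv_on_eq has_real_derivative_iff_has_vector_derivative by metis
qed

section \<open>Smoothness on the interval\<close>

text \<open>An explicit sequence \<open>F\<close> certifies smoothness: by induction the iterated
  derivatives agree with it on \<open>I\<close>, and agreement on \<open>I\<close> is enough for
  derivatives within \<open>I\<close>.\<close>

lemma smooth_onI:
  assumes F: "\<And>n s. s \<in> I \<Longrightarrow> (F n has_vector_derivative F (Suc n) s) (at s within I)"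
    and f: "\<And>s. s \<in> I \<Longrightarrow> f s = F 0 s"
  shows "smooth_on I f"
proof -
  have eq: "\<forall>s\<in>I. (deriv_on I ^^ n) f s = F n s" for n
  proof (induction n)
    case (Suc n)
    show ?case
    proof
      fix s assume s: "s \<in> I"
      have "((deriv_on I ^^ n) f has_vector_derivative F (Suc n) s) (at s within I)"
        using Suc s by (intro has_vector_derivative_transform[OF _ _ F[OF s]]) auto
      then show "(deriv_on I ^^ Suc n) f s = F (Suc n) s"
        using deriv_on_eq s by simp
    qed
  qed (simp add: f)
  show ?thesis
    unfolding smooth_on_def
  proof (intro allI ballI)
    fix n s assume s: "s \<in> I"
    have "((deriv_on I ^^ n) f has_vector_derivative F (Suc n) s) (at s within I)"
      using eq s by (intro has_vector_derivative_transform[OF _ _ F[OF s]]) auto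
    then show "(deriv_on I ^^ n) f differentiable at s within I"
      by (rule differentiableI_vector)
  qed
qed

lemma smooth_on_iterated_derivative:
  assumes "smooth_on I f" "s \<in> I"
  shows "((deriv_on I ^^ n) f has_vector_derivative (deriv_on I ^^ Suc n) f s) (at s within I)"
  using assms unfolding smooth_on_def deriv_on_def
  by (auto simp: vector_derivative_works[symmetric])

lemma smooth_on_has_vector_derivative:
  assumes "smooth_on I f" "s \<in> I"
  shows "(f has_vector_derivative deriv_on I f s) (at s within I)"
  using smooth_on_iterated_derivative[OF assms, of 0] by simp

lemma smooth_on_deriv_on: "smooth_on I f \<Longrightarrow> smooth_on I (deriv_on I f)"
  by (rule smooth_onI[where F = "\<lambda>n. (deriv_on I ^^ Suc n) f"])
     (use smooth_on_iterated_derivative[of f _ "Suc _"] in auto)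

lemma smooth_on_antiderivative:
  assumes "smooth_on I g" "\<And>s. s \<in> I \<Longrightarrow> (f has_vector_derivative g s) (at s within I)"
  shows "smooth_on I f"
  by (rule smooth_onI[where F = "case_nat f (\<lambda>n. (deriv_on I ^^ n) g)"])
     (use assms smooth_on_iterated_derivative in \<open>auto split: nat.split\<close>)

lemma smooth_on_add:
  assumes "smooth_on I f" "smooth_on I g"
  shows "smooth_on I (\<lambda>s. f s + g s)"
  by (rule smooth_onI[where F = "\<lambda>n s. (deriv_on I ^^ n) f s + (deriv_on I ^^ n) g s"])
     (use assms has_vector_derivative_add smooth_on_iterated_derivative in \<open>blast, simp\<close>)

lemma smooth_on_bounded_linear:
  assumes "bounded_linear L" "smooth_on I f"
  shows "smooth_on I (\<lambda>s. L (f s))"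
  by (rule smooth_onI[where F = "\<lambda>n s. L ((deriv_on I ^^ n) f s)"])
     (use assms bounded_linear.has_vector_derivative smooth_on_iterated_derivative in
       \<open>blast, simp\<close>)

text \<open>Each differentiation contributes a factor \<open>c\<close> and a phase shift by
  \<open>pi / 2\<close>, which gives a closed form for all derivatives. The phase \<open>d\<close>
  makes cosine a special case.\<close>

lemma smooth_on_sin: "smooth_on I (\<lambda>s. sin (c * s + d))"
proof (rule smooth_onI[where F = "\<lambda>n s. c ^ n * sin (c * s + d + n * (pi / 2))"])
  fix n and s :: real
  have "c * s + d + Suc n * (pi / 2) = (c * s + d + n * (pi / 2)) + pi / 2"
    by (simp add: algebra_simps)
  then have "sin (c * s + d + Suc n * (pi / 2)) = cos (c * s + d + n * (pi / 2))"
    by (simp only: sin_add) simp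
  then show "((\<lambda>s. c ^ n * sin (c * s + d + n * (pi / 2))) has_vector_derivative
      c ^ Suc n * sin (c * s + d + Suc n * (pi / 2))) (at s within I)"
    unfolding has_real_derivative_iff_has_vector_derivative[symmetric]
    by (auto intro!: derivative_eq_intros)
qed simp

lemma smooth_on_cos: "smooth_on I (\<lambda>s. cos (c * s))"
proof -
  have "cos (c * s) = sin (c * s + pi / 2)" for s by (simp add: sin_add)
  then show ?thesis using smooth_on_sin[of c "pi / 2"] by simp
qed

text \<open>Coordinate projections are bounded linear; conversely, the vectors of iterated component
  derivatives form a derivative sequence for \<open>r\<close>.\<close>

lemma smooth_on_component_iff:
  fixes r :: "real \<Rightarrow> real ^ 'n"
  shows "smooth_on I r \<longleftrightarrow> (\<forall>i. smooth_on I (\<lambda>s. r s $ i))"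
proof
  assume "smooth_on I r"
  then show "\<forall>i. smooth_on I (\<lambda>s. r s $ i)"
    using smooth_on_bounded_linear[OF bounded_linear_vec_nth] by blast
next
  assume r: "\<forall>i. smooth_on I (\<lambda>s. r s $ i)"
  let ?F = "\<lambda>n s. \<chi> i. (deriv_on I ^^ n) (\<lambda>s. r s $ i) s"
  show "smooth_on I r"
  proof (rule smooth_onI[where F = ?F])
    fix n s assume s: "s \<in> I"
    show "(?F n has_vector_derivative ?F (Suc n) s) (at s within I)"
      unfolding has_vector_derivative_def
    proof (subst has_derivative_componentwise_within, rule ballI)
      fix b :: "real ^ 'n" assume "b \<in> Basis"
      then obtain i where b: "b = axis i 1" by (auto simp: Basis_vec_def)
      show "((\<lambda>x. ?F n x \<bullet> b) has_derivative (\<lambda>x. (x *\<^sub>R ?F (Suc n) s) \<bullet> b)) (at s within I)"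
        using smooth_on_iterated_derivative[OF r[rule_format, of i] s, of n]
        by (simp add: b inner_axis has_vector_derivative_def)
    qed
  qed (simp add: vec_eq_iff)
qed

lemma smooth_on_coords_iff:
  "smooth_on I r \<longleftrightarrow> smooth_on I (x_coord r) \<and> smooth_on I (y_coord r) \<and> smooth_on I (z_coord r)"
  by (simp add: smooth_on_component_iff forall_3 x_coord_def[abs_def] y_coord_def[abs_def]
      z_coord_def[abs_def])

section \<open>Differentiating the height formula\<close>

text \<open>The fundamental theorem of calculus is applied on a compact interval containing both the
  base point and \<open>s\<close>, whereas \<open>I\<close> may be open or unbounded. The equality
  of filters carries the result back to \<open>I\<close>.\<close>

lemma at_within_closed_subinterval:
  assumes "s \<in> I" "s\<^sub>0 \<in> I"
  obtains a b where "{a..b} \<subseteq> I" "a \<le> s" "s \<le> b" "a \<le> s\<^sub>0" "s\<^sub>0 \<le> b"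
    "at s within I = at s within {a..b}"
proof -
  obtain a where a: "a \<in> I" "a \<le> s" "a \<le> s\<^sub>0" "a < s \<or> (\<forall>t\<in>I. s \<le> t)"
  proof (cases "\<exists>t\<in>I. t < s")
    case True
    then obtain t where "t \<in> I" "t < s" by blast
    then show ?thesis using that[of "min t s\<^sub>0"] assms by (auto simp: min_def)
  next
    case False
    then show ?thesis using that[of s] assms by force
  qed
  obtain b where b: "b \<in> I" "s \<le> b" "s\<^sub>0 \<le> b" "s < b \<or> (\<forall>t\<in>I. t \<le> s)"
  proof (cases "\<exists>t\<in>I. s < t")
    case True
    then obtain t where "t \<in> I" "s < t" by blast
    then show ?thesis using that[of "max t s\<^sub>0"] assms by (auto simp: max_def)
  next
    case False
    then show ?thesis using that[of s] assms by force
  qed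
  have sub: "{a..b} \<subseteq> I"
    using interval a(1) b(1) unfolding is_interval_1 by (meson atLeastAtMost_iff subsetI)
  \<comment> \<open>A neighbourhood of \<open>s\<close> on which \<open>I\<close> and
    \<open>{a..b}\<close> coincide. No cut is made on a side where \<open>s\<close> is an endpoint
    of \<open>I\<close>.\<close>
  let ?U = "(if a < s then {a<..} else UNIV) \<inter> (if s < b then {..<b} else UNIV)"
  have "at s within I = at s within {a..b}"
  proof (rule at_within_nhd[of s ?U])
    show "I \<inter> ?U - {s} = {a..b} \<inter> ?U - {s}"
    proof
      show "I \<inter> ?U - {s} \<subseteq> {a..b} \<inter> ?U - {s}"
        using a b by (force split: if_splits)
      show "{a..b} \<inter> ?U - {s} \<subseteq> I \<inter> ?U - {s}"
        using sub by auto
    qed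
  qed auto
  then show ?thesis using that a b sub by blast
qed

lemma has_real_derivative_interval_integral:
  assumes "s\<^sub>0 \<in> I" "s \<in> I" "continuous_on I f"
  shows "((\<lambda>u. LBINT t=s\<^sub>0..u. f t) has_real_derivative f s) (at s within I)"
proof -
  obtain a b where "{a..b} \<subseteq> I" "a \<le> s" "s \<le> b" "a \<le> s\<^sub>0" "s\<^sub>0 \<le> b"
    and eq: "at s within I = at s within {a..b}"
    using at_within_closed_subinterval assms by metis
  then show ?thesis
    unfolding has_real_derivative_iff_has_vector_derivative eq
    using assms by (intro interval_integral_FTC2 continuous_on_subset[OF assms(3)]) auto
qed

text \<open>Serves both directions: the normality forces this derivative on the third coordinate of
  a curve, and a lift with this derivative has the prescribed normality.\<close>

lemma height_formula_has_real_derivative: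
  assumes "s\<^sub>0 \<in> I" "s \<in> I" "continuous_on I \<tau>" "\<kappa> \<noteq> 0"
  shows "(height_formula s\<^sub>0 \<kappa> \<tau> C1 C2 C4 has_real_derivative
      \<tau> s + C1 / 2 * cos (\<kappa> * s) - C2 / 2 * sin (\<kappa> * s) - 1 / \<kappa>) (at s within I)"
proof -
  note [derivative_intros] = has_real_derivative_interval_integral[OF assms(1-3)]
  show ?thesis
    unfolding height_formula_def
    by (rule derivative_eq_intros refl assms(4))+ (use assms(4) in \<open>simp add: field_simps\<close>)
qed

section \<open>Constants of integration and their uniqueness\<close>

lemma constant_of_zero_derivative:
  fixes f :: "real \<Rightarrow> real"
  assumes "\<And>s. s \<in> I \<Longrightarrow> (f has_real_derivative 0) (at s within I)"
  shows "\<exists>c. \<forall>s\<in>I. f s = c"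
  using has_field_derivative_zero_constant[of I f] assms interval is_interval_convex by metis

text \<open>The first two derivatives at a single point determine the trigonometric coefficients,
  and the value there then determines the constant term.\<close>

lemma radius_sq_formula_unique:
  assumes "\<kappa> \<noteq> 0"
    and eq: "\<And>s. s \<in> I \<Longrightarrow> radius_sq_formula \<kappa> C1 C2 C3 s = radius_sq_formula \<kappa> D1 D2 D3 s"
  shows "C1 = D1" "C2 = D2" "C3 = D3"
proof -
  obtain s where s: "s \<in> I" using interior_nonempty interior_subset by blast
  have 1: "C1 * sin (\<kappa> * t) + C2 * cos (\<kappa> * t) = D1 * sin (\<kappa> * t) + D2 * cos (\<kappa> * t)"
    if "t \<in> I" for t
  proof (rule has_real_derivative_unique[OF eq that])
    have *: "(radius_sq_formula \<kappa> A B C has_real_derivative A * sin (\<kappa> * t) + B * cos (\<kappa> * t))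
        (at t within I)" for A B C
      unfolding radius_sq_formula_def
      by (rule derivative_eq_intros refl assms(1))+ (use assms(1) in \<open>simp add: field_simps\<close>)
    show "(radius_sq_formula \<kappa> C1 C2 C3 has_real_derivative C1 * sin (\<kappa> * t) + C2 * cos (\<kappa> * t))
        (at t within I)"
      and "(radius_sq_formula \<kappa> D1 D2 D3 has_real_derivative D1 * sin (\<kappa> * t) + D2 * cos (\<kappa> * t))
        (at t within I)"
      by (rule *)+
  qed
  have 2: "\<kappa> * (C1 * cos (\<kappa> * s) - C2 * sin (\<kappa> * s)) = \<kappa> * (D1 * cos (\<kappa> * s) - D2 * sin (\<kappa> * s))"
  proof (rule has_real_derivative_unique[OF 1 s])
    have *: "((\<lambda>t. A * sin (\<kappa> * t) + B * cos (\<kappa> * t)) has_real_derivative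
        \<kappa> * (A * cos (\<kappa> * s) - B * sin (\<kappa> * s))) (at s within I)" for A B
      by (rule derivative_eq_intros refl)+ (simp add: algebra_simps)
    show "((\<lambda>t. C1 * sin (\<kappa> * t) + C2 * cos (\<kappa> * t)) has_real_derivative
        \<kappa> * (C1 * cos (\<kappa> * s) - C2 * sin (\<kappa> * s))) (at s within I)"
      and "((\<lambda>t. D1 * sin (\<kappa> * t) + D2 * cos (\<kappa> * t)) has_real_derivative
        \<kappa> * (D1 * cos (\<kappa> * s) - D2 * sin (\<kappa> * s))) (at s within I)"
      by (rule *)+
  qed
  \<comment> \<open>The vector \<open>(?q, ?p)\<close> is \<open>(C1 - D1, C2 - D2)\<close> rotated
    by the angle \<open>\<kappa> * s\<close>, so both have the same length.\<close>
  let ?p = "(C1 - D1) * sin (\<kappa> * s) + (C2 - D2) * cos (\<kappa> * s)"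
  let ?q = "(C1 - D1) * cos (\<kappa> * s) - (C2 - D2) * sin (\<kappa> * s)"
  have pq: "?p = 0" "?q = 0"
    using 1[OF s] 2[unfolded mult_cancel_left] assms(1) by (simp_all add: algebra_simps)
  have "(C1 - D1)\<^sup>2 + (C2 - D2)\<^sup>2 = ((C1 - D1)\<^sup>2 + (C2 - D2)\<^sup>2) * ((sin (\<kappa> * s))\<^sup>2 + (cos (\<kappa> * s))\<^sup>2)"
    by simp
  also have "\<dots> = ?p\<^sup>2 + ?q\<^sup>2" by algebra
  finally have "(C1 - D1)\<^sup>2 + (C2 - D2)\<^sup>2 = 0" using pq by simp
  then show *: "C1 = D1" "C2 = D2" by (auto simp: sum_power2_eq_zero_iff)
  show "C3 = D3" using eq[OF s] assms(1) * by (simp add: radius_sq_formula_def)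
qed

end

lemma radius_sq: "(radius r s)\<^sup>2 = (x_coord r s)\<^sup>2 + (y_coord r s)\<^sup>2"
  by (simp add: radius_def)

text \<open>The right-hand side is the squared distance from the origin to a point of the circle
  with centre \<open>(C2 / 2, C1 / 2)\<close> and radius \<open>1 / \<bar>\<kappa>\<bar>\<close>.
  Nonnegativity is then evident.\<close>

lemma radius_sq_formula_compatible:
  assumes "\<kappa> \<noteq> 0" "compatible \<kappa> C1 C2 C3"
  shows "radius_sq_formula \<kappa> C1 C2 C3 s =
    (sin (\<kappa> * s) / \<kappa> + C2 / 2)\<^sup>2 + (C1 / 2 - cos (\<kappa> * s) / \<kappa>)\<^sup>2"
proof -
  \<comment> \<open>Stated for arbitrary \<open>u\<close> and \<open>v\<close> so that the algebra
    is purely rational; sine and cosine are substituted afterwards.\<close>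
  have "(u / \<kappa> + C2 / 2)\<^sup>2 + (C1 / 2 - v / \<kappa>)\<^sup>2 =
    (u\<^sup>2 + v\<^sup>2) / \<kappa>\<^sup>2 + (C1\<^sup>2 + C2\<^sup>2) / 4 + (C2 * u - C1 * v) / \<kappa>" for u v
    using assms(1) by (simp add: field_simps power2_eq_square)
  from this[of "sin (\<kappa> * s)" "cos (\<kappa> * s)"]
  have "(sin (\<kappa> * s) / \<kappa> + C2 / 2)\<^sup>2 + (C1 / 2 - cos (\<kappa> * s) / \<kappa>)\<^sup>2 =
    1 / \<kappa>\<^sup>2 + (C1\<^sup>2 + C2\<^sup>2) / 4 + (C2 * sin (\<kappa> * s) - C1 * cos (\<kappa> * s)) / \<kappa>"
    by simp
  also have "\<dots> = radius_sq_formula \<kappa> C1 C2 C3 s"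
    using assms by (simp add: radius_sq_formula_def compatible_def field_simps power2_eq_square)
  finally show ?thesis ..
qed

section \<open>Representing a given curve\<close>

context parameter_interval
begin

lemma const_curvature_curve_represented:
  assumes s\<^sub>0: "s\<^sub>0 \<in> I" and \<kappa>: "\<kappa> \<noteq> 0" and curve: "const_curvature_curve I \<kappa> \<tau> r"
  obtains C1 C2 C3 C4 where "represented_by I s\<^sub>0 \<kappa> \<tau> r C1 C2 C3 C4" "compatible \<kappa> C1 C2 C3"
proof -
  define x where "x = x_coord r"
  define y where "y = y_coord r"
  define z where "z = z_coord r"
  define x1 where "x1 = deriv_on I x"
  define y1 where "y1 = deriv_on I y"
  define z1 where "z1 = deriv_on I z"
  define x2 where "x2 = deriv_on I x1"
  define y2 where "y2 = deriv_on I y1"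
  note defs = x_def y_def z_def x1_def y1_def z1_def x2_def y2_def
  have smooth: "smooth_on I x" "smooth_on I y" "smooth_on I z"
    using curve smooth_on_coords_iff by (auto simp: const_curvature_curve_def defs)
  then have smooth1: "smooth_on I x1" "smooth_on I y1" "smooth_on I z1"
    by (auto simp: x1_def y1_def z1_def smooth_on_deriv_on)
  have D[derivative_intros]:
    "(x has_real_derivative x1 s) (at s within I)" "(y has_real_derivative y1 s) (at s within I)"
    "(z has_real_derivative z1 s) (at s within I)"
    "(x1 has_real_derivative x2 s) (at s within I)" "(y1 has_real_derivative y2 s) (at s within I)"
    if "s \<in> I" for s
    using that smooth smooth1 smooth_on_has_vector_derivative
    by (auto simp: has_real_derivative_iff_has_vector_derivative x1_def y1_def z1_def x2_def y2_def)
  have unit: "(x1 s)\<^sup>2 + (y1 s)\<^sup>2 = 1"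
    and curvature: "x1 s * y2 s - x2 s * y1 s = \<kappa>"
    and normality: "x s * y1 s - x1 s * y s + z1 s = \<tau> s" if "s \<in> I" for s
    using curve that
    by (auto simp: const_curvature_curve_def horizontal_arclength_def p_curvature_def
        contact_normality_def defs)
  have orth: "x1 s * x2 s + y1 s * y2 s = 0" if s: "s \<in> I" for s
  proof -
    have "2 * (x1 s * x2 s + y1 s * y2 s) = 0"
    proof (rule has_real_derivative_unique[OF unit s])
      show "((\<lambda>s. (x1 s)\<^sup>2 + (y1 s)\<^sup>2) has_real_derivative 2 * (x1 s * x2 s + y1 s * y2 s))
          (at s within I)"
        by (rule derivative_eq_intros refl s)+ (simp add: algebra_simps)
    qed (auto intro: DERIV_const)
    then show ?thesis by simp
  qed
  \<comment> \<open>Orthogonality and curvature form a linear system for \<open>x2 s\<close> and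
    \<open>y2 s\<close> whose determinant is the squared speed 1.\<close>
  have x2: "x2 s = - \<kappa> * y1 s" and y2: "y2 s = \<kappa> * x1 s" if s: "s \<in> I" for s
    using unit[OF s] curvature[OF s] orth[OF s] by algebra+
  \<comment> \<open>With \<open>b\<close> below, this locates the centre
    \<open>(- b / \<kappa>, a / \<kappa>)\<close> of the circle on which the planar projection
    runs.\<close>
  have "\<exists>a. \<forall>s\<in>I. x1 s + \<kappa> * y s = a"
  proof (rule constant_of_zero_derivative)
    show "((\<lambda>s. x1 s + \<kappa> * y s) has_real_derivative 0) (at s within I)" if s: "s \<in> I" for s
      by (rule derivative_eq_intros refl s)+ (simp add: x2 s)
  qed
  then obtain a where a: "\<And>s. s \<in> I \<Longrightarrow> x1 s + \<kappa> * y s = a" by blast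
  have "\<exists>b. \<forall>s\<in>I. y1 s - \<kappa> * x s = b"
  proof (rule constant_of_zero_derivative)
    show "((\<lambda>s. y1 s - \<kappa> * x s) has_real_derivative 0) (at s within I)" if s: "s \<in> I" for s
      by (rule derivative_eq_intros refl s)+ (simp add: y2 s)
  qed
  then obtain b where b: "\<And>s. s \<in> I \<Longrightarrow> y1 s - \<kappa> * x s = b" by blast
  \<comment> \<open>The pair \<open>(A, B)\<close> is the velocity turned back by the angle
    \<open>\<kappa> * s\<close>.\<close>
  have "\<exists>A. \<forall>s\<in>I. x1 s * cos (\<kappa> * s) + y1 s * sin (\<kappa> * s) = A"
  proof (rule constant_of_zero_derivative)
    show "((\<lambda>s. x1 s * cos (\<kappa> * s) + y1 s * sin (\<kappa> * s)) has_real_derivative 0) (at s within I)"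
      if s: "s \<in> I" for s
      by (rule derivative_eq_intros refl s)+ (simp add: x2 y2 s algebra_simps)
  qed
  then obtain A where A: "\<And>s. s \<in> I \<Longrightarrow> x1 s * cos (\<kappa> * s) + y1 s * sin (\<kappa> * s) = A" by blast
  have "\<exists>B. \<forall>s\<in>I. y1 s * cos (\<kappa> * s) - x1 s * sin (\<kappa> * s) = B"
  proof (rule constant_of_zero_derivative)
    show "((\<lambda>s. y1 s * cos (\<kappa> * s) - x1 s * sin (\<kappa> * s)) has_real_derivative 0) (at s within I)"
      if s: "s \<in> I" for s
      by (rule derivative_eq_intros refl s)+ (simp add: x2 y2 s algebra_simps)
  qed
  then obtain B where B: "\<And>s. s \<in> I \<Longrightarrow> y1 s * cos (\<kappa> * s) - x1 s * sin (\<kappa> * s) = B" by blast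
  have AB: "A\<^sup>2 + B\<^sup>2 = 1"
  proof -
    have "A\<^sup>2 + B\<^sup>2 = ((x1 s\<^sub>0)\<^sup>2 + (y1 s\<^sub>0)\<^sup>2) * ((sin (\<kappa> * s\<^sub>0))\<^sup>2 + (cos (\<kappa> * s\<^sub>0))\<^sup>2)"
      unfolding A[OF s\<^sub>0, symmetric] B[OF s\<^sub>0, symmetric] by algebra
    then show ?thesis by (simp add: unit s\<^sub>0)
  qed
  have x1: "x1 s = A * cos (\<kappa> * s) - B * sin (\<kappa> * s)"
    and y1: "y1 s = A * sin (\<kappa> * s) + B * cos (\<kappa> * s)" if s: "s \<in> I" for s
  proof -
    have "x1 s * ((sin (\<kappa> * s))\<^sup>2 + (cos (\<kappa> * s))\<^sup>2) = A * cos (\<kappa> * s) - B * sin (\<kappa> * s)"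
      "y1 s * ((sin (\<kappa> * s))\<^sup>2 + (cos (\<kappa> * s))\<^sup>2) = A * sin (\<kappa> * s) + B * cos (\<kappa> * s)"
      unfolding A[OF s, symmetric] B[OF s, symmetric] by algebra+
    then show "x1 s = A * cos (\<kappa> * s) - B * sin (\<kappa> * s)"
      "y1 s = A * sin (\<kappa> * s) + B * cos (\<kappa> * s)"
      by simp_all
  qed
  have x: "x s = (y1 s - b) / \<kappa>" and y: "y s = (a - x1 s) / \<kappa>" if s: "s \<in> I" for s
    using a[OF s] b[OF s] \<kappa> by (auto simp: field_simps)
  \<comment> \<open>\<open>C1\<close> and \<open>C2\<close> are read off from expanding
    \<open>a * x1 s + b * y1 s\<close> in cosine and sine, as in \<open>trig\<close>;
    \<open>C3\<close> collects the constant part of the squared radius.\<close>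
  define C1 where "C1 = 2 * (a * A + b * B) / \<kappa>"
  define C2 where "C2 = 2 * (a * B - b * A) / \<kappa>"
  define C3 where "C3 = (1 + a\<^sup>2 + b\<^sup>2) / \<kappa>"
  have C12: "C1\<^sup>2 + C2\<^sup>2 = 4 * (a\<^sup>2 + b\<^sup>2) / \<kappa>\<^sup>2"
  proof -
    have "C1\<^sup>2 + C2\<^sup>2 = 4 * ((a * A + b * B)\<^sup>2 + (a * B - b * A)\<^sup>2) / \<kappa>\<^sup>2"
      using \<kappa> by (simp add: C1_def C2_def field_simps power2_eq_square)
    also have "(a * A + b * B)\<^sup>2 + (a * B - b * A)\<^sup>2 = a\<^sup>2 + b\<^sup>2" using AB by algebra
    finally show ?thesis .
  qed
  have compatible: "compatible \<kappa> C1 C2 C3"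
    unfolding compatible_def C12 C3_def using \<kappa> by (simp add: field_simps power2_eq_square)
  have trig: "a * x1 s + b * y1 s = \<kappa> / 2 * (C1 * cos (\<kappa> * s) - C2 * sin (\<kappa> * s))"
    if s: "s \<in> I" for s
    using \<kappa> by (simp add: C1_def C2_def x1 y1 s field_simps)
  have radius: "(radius r s)\<^sup>2 = radius_sq_formula \<kappa> C1 C2 C3 s" if s: "s \<in> I" for s
  proof -
    have "(radius r s)\<^sup>2 = (x s)\<^sup>2 + (y s)\<^sup>2" by (simp add: radius_sq x_def y_def)
    also have "\<dots> = ((y1 s - b)\<^sup>2 + (a - x1 s)\<^sup>2) / \<kappa>\<^sup>2"
      by (simp add: x[OF s] y[OF s] power_divide add_divide_distrib)
    also have "(y1 s - b)\<^sup>2 + (a - x1 s)\<^sup>2 = 1 + a\<^sup>2 + b\<^sup>2 - 2 * (a * x1 s + b * y1 s)"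
      using unit[OF s] by algebra
    finally show ?thesis
      using \<kappa> unfolding trig[OF s]
      by (simp add: radius_sq_formula_def C3_def field_simps power2_eq_square)
  qed
  have z1: "z1 s = \<tau> s + C1 / 2 * cos (\<kappa> * s) - C2 / 2 * sin (\<kappa> * s) - 1 / \<kappa>" if s: "s \<in> I" for s
  proof -
    \<comment> \<open>Substitutes \<open>\<kappa> * x s = y1 s - b\<close> and
      \<open>\<kappa> * y s = a - x1 s\<close>.\<close>
    have "\<kappa> * (x s * y1 s - x1 s * y s) = (x1 s)\<^sup>2 + (y1 s)\<^sup>2 - (a * x1 s + b * y1 s)"
      unfolding a[OF s, symmetric] b[OF s, symmetric] by algebra
    then have "x s * y1 s - x1 s * y s = 1 / \<kappa> - 1 / 2 * (C1 * cos (\<kappa> * s) - C2 * sin (\<kappa> * s))"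
      using \<kappa> unfolding trig[OF s] unit[OF s] by (simp add: field_simps)
    then show ?thesis using normality[OF s] by (simp add: algebra_simps)
  qed
  \<comment> \<open>\<open>\<tau>\<close> is only known to match the normality on \<open>I\<close>;
    the continuity required for differentiating its integral is inherited from the
    coordinates.\<close>
  have cont: "continuous_on I \<tau>"
  proof -
    have "continuous_on I f" if "smooth_on I f" for f :: "real \<Rightarrow> real"
      using smooth_on_has_vector_derivative[OF that] has_vector_derivative_continuous
        continuous_on_eq_continuous_within by blast
    then have "continuous_on I (\<lambda>s. x s * y1 s - x1 s * y s + z1 s)"
      using smooth smooth1 by (intro continuous_intros) auto
    then show ?thesis using normality by (simp cong: continuous_on_cong)
  qed
  \<comment> \<open>The last parameter is a pure shift, so it is set to 0 here and recovered as the
    constant difference.\<close>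
  have "\<exists>C4. \<forall>s\<in>I. z s - height_formula s\<^sub>0 \<kappa> \<tau> C1 C2 0 s = C4"
  proof (rule constant_of_zero_derivative)
    show "((\<lambda>s. z s - height_formula s\<^sub>0 \<kappa> \<tau> C1 C2 0 s) has_real_derivative 0) (at s within I)"
      if s: "s \<in> I" for s
      by (rule derivative_eq_intros height_formula_has_real_derivative refl s s\<^sub>0 cont \<kappa>)+
         (simp add: z1 s)
  qed
  then obtain C4 where C4: "\<And>s. s \<in> I \<Longrightarrow> z s - height_formula s\<^sub>0 \<kappa> \<tau> C1 C2 0 s = C4" by blast
  have "z_coord r s = height_formula s\<^sub>0 \<kappa> \<tau> C1 C2 C4 s" if "s \<in> I" for s
    using C4[OF that] by (simp add: height_formula_def z_def)
  then have "represented_by I s\<^sub>0 \<kappa> \<tau> r C1 C2 C3 C4"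
    using radius by (simp add: represented_by_def)
  then show ?thesis using that compatible by blast
qed

text \<open>The radius formula fixes the first three constants, so any representing tuple shares
  them with the compatible one already found.\<close>

lemma represented_by_compatible:
  assumes "s\<^sub>0 \<in> I" "\<kappa> \<noteq> 0" "const_curvature_curve I \<kappa> \<tau> r"
    and rep: "represented_by I s\<^sub>0 \<kappa> \<tau> r C1 C2 C3 C4"
  shows "compatible \<kappa> C1 C2 C3"
proof -
  obtain D1 D2 D3 D4 where D: "represented_by I s\<^sub>0 \<kappa> \<tau> r D1 D2 D3 D4" "compatible \<kappa> D1 D2 D3"
    using const_curvature_curve_represented assms(1-3) by blast
  have "radius_sq_formula \<kappa> C1 C2 C3 s = radius_sq_formula \<kappa> D1 D2 D3 s" if "s \<in> I" for s
    using rep D(1) that by (simp add: represented_by_def)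
  then show ?thesis using radius_sq_formula_unique[OF assms(2)] D(2) by metis
qed

section \<open>Realizing prescribed constants\<close>

lemma const_curvature_curve_exists:
  assumes s\<^sub>0: "s\<^sub>0 \<in> I" and \<kappa>: "\<kappa> \<noteq> 0" and \<tau>: "smooth_on I \<tau>" and compatible: "compatible \<kappa> C1 C2 C3"
  obtains r where "const_curvature_curve I \<kappa> \<tau> r" "represented_by I s\<^sub>0 \<kappa> \<tau> r C1 C2 C3 C4"
proof -
  \<comment> \<open>The direction angle is normalized to \<open>\<kappa> * s\<close>, the case
    \<open>A = 1\<close>, \<open>B = 0\<close> of the preceding analysis, where the centre
    \<open>(- b / \<kappa>, a / \<kappa>)\<close> becomes \<open>(C2 / 2, C1 / 2)\<close>.\<close>
  define x where "x s = sin (\<kappa> * s) / \<kappa> + C2 / 2" for s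
  define y where "y s = C1 / 2 - cos (\<kappa> * s) / \<kappa>" for s
  define z where "z = height_formula s\<^sub>0 \<kappa> \<tau> C1 C2 C4"
  define z1 where "z1 s = \<tau> s + C1 / 2 * cos (\<kappa> * s) - C2 / 2 * sin (\<kappa> * s) - 1 / \<kappa>" for s
  define r :: "real \<Rightarrow> heisenberg" where "r s = vector [x s, y s, z s]" for s
  have coords: "x_coord r = x" "y_coord r = y" "z_coord r = z"
    by (auto simp: x_coord_def y_coord_def z_coord_def r_def)
  have cont: "continuous_on I \<tau>"
    using smooth_on_has_vector_derivative[OF \<tau>] has_vector_derivative_continuous
      continuous_on_eq_continuous_within by blast
  have D: "(x has_vector_derivative cos (\<kappa> * s)) (at s within I)"
    "(y has_vector_derivative sin (\<kappa> * s)) (at s within I)"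
    "(z has_vector_derivative z1 s) (at s within I)" if s: "s \<in> I" for s
    using height_formula_has_real_derivative[OF s\<^sub>0 s cont \<kappa>] \<kappa>
    unfolding has_real_derivative_iff_has_vector_derivative[symmetric] x_def y_def z_def z1_def
    by (auto intro!: derivative_eq_intros)
  have D1: "deriv_on I x s = cos (\<kappa> * s)" "deriv_on I y s = sin (\<kappa> * s)" "deriv_on I z s = z1 s"
    if "s \<in> I" for s
    using D[OF that] deriv_on_eq[OF that] by blast+
  have D2: "deriv_on I (deriv_on I x) s = - \<kappa> * sin (\<kappa> * s)"
    "deriv_on I (deriv_on I y) s = \<kappa> * cos (\<kappa> * s)" if s: "s \<in> I" for s
  proof -
    have *: "((\<lambda>s. cos (\<kappa> * s)) has_vector_derivative - \<kappa> * sin (\<kappa> * s)) (at s within I)"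
      "((\<lambda>s. sin (\<kappa> * s)) has_vector_derivative \<kappa> * cos (\<kappa> * s)) (at s within I)"
      unfolding has_real_derivative_iff_has_vector_derivative[symmetric]
      by (auto intro!: derivative_eq_intros)
    show "deriv_on I (deriv_on I x) s = - \<kappa> * sin (\<kappa> * s)"
      by (rule deriv_on_eq[OF s has_vector_derivative_transform[OF s D1(1) *(1)]])
    show "deriv_on I (deriv_on I y) s = \<kappa> * cos (\<kappa> * s)"
      by (rule deriv_on_eq[OF s has_vector_derivative_transform[OF s D1(2) *(2)]])
  qed
  have smooth_trig: "smooth_on I (\<lambda>s. sin (\<kappa> * s))" "smooth_on I (\<lambda>s. cos (\<kappa> * s))"
    using smooth_on_sin[of \<kappa> 0] smooth_on_cos by auto
  have smooth_const: "smooth_on I (\<lambda>s. c)" for c :: real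
    by (rule smooth_onI[where F = "\<lambda>n s. if n = 0 then c else 0"]) auto
  have smooth_scaled: "smooth_on I (\<lambda>s. c * f s)" if "smooth_on I f" for c :: real and f
    using smooth_on_bounded_linear[OF bounded_linear_mult_right that] .
  \<comment> \<open>The height contains an integral, so its smoothness is obtained from that of its
    derivative.\<close>
  have "smooth_on I z1"
  proof -
    have "smooth_on I (\<lambda>s. \<tau> s + (C1 / 2 * cos (\<kappa> * s) + ((- C2 / 2) * sin (\<kappa> * s) + - 1 / \<kappa>)))"
      by (rule smooth_on_add smooth_scaled smooth_trig smooth_const \<tau>)+
    then show ?thesis by (simp add: z1_def[abs_def] algebra_simps)
  qed
  then have "smooth_on I x" "smooth_on I y" "smooth_on I z"
    using smooth_on_antiderivative D smooth_trig by blast+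
  then have "smooth_on I r" by (simp add: smooth_on_coords_iff coords)
  moreover have "contact_normality I r s = \<tau> s" if s: "s \<in> I" for s
  proof -
    have "(u / \<kappa> + C2 / 2) * u - v * (C1 / 2 - v / \<kappa>) =
        (u\<^sup>2 + v\<^sup>2) / \<kappa> - C1 / 2 * v + C2 / 2 * u" for u v
      by (simp add: algebra_simps power2_eq_square add_divide_distrib)
    from this[of "sin (\<kappa> * s)" "cos (\<kappa> * s)"]
    have "x s * sin (\<kappa> * s) - cos (\<kappa> * s) * y s =
        1 / \<kappa> - C1 / 2 * cos (\<kappa> * s) + C2 / 2 * sin (\<kappa> * s)"
      by (simp add: x_def y_def)
    then show ?thesis by (simp add: contact_normality_def coords D1 s z1_def)
  qed
  moreover have "p_curvature I r s = \<kappa>" if s: "s \<in> I" for s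
  proof -
    have "p_curvature I r s = \<kappa> * ((sin (\<kappa> * s))\<^sup>2 + (cos (\<kappa> * s))\<^sup>2)"
      by (simp only: p_curvature_def coords D1 D2 s) algebra
    then show ?thesis by simp
  qed
  ultimately have "const_curvature_curve I \<kappa> \<tau> r"
    by (simp add: const_curvature_curve_def horizontally_regular_def horizontal_arclength_def
        coords D1)
  moreover have "represented_by I s\<^sub>0 \<kappa> \<tau> r C1 C2 C3 C4"
    using radius_sq_formula_compatible[OF \<kappa> compatible]
    by (simp add: represented_by_def radius_sq coords x_def y_def z_def)
  ultimately show ?thesis using that by blast
qed

end

text \<open>Compatibility is asserted for every representing tuple. The absence of further
  conditions is expressed as realizability: for each smooth \<open>\<tau>\<close>, all values of
  \<open>C1\<close>, \<open>C2\<close> and \<open>C4\<close> occur, with \<open>C3\<close> given by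
  compatibility.\<close>

theorem corollary3p4:
  fixes I :: "real set" and s\<^sub>0 \<kappa>\<^sub>0 :: real
  assumes "is_interval I" and "interior I \<noteq> {}" and "s\<^sub>0 \<in> I" and "\<kappa>\<^sub>0 \<noteq> 0"
  shows
    "(\<forall>\<tau> r. const_curvature_curve I \<kappa>\<^sub>0 \<tau> r \<longrightarrow>
        (\<exists>C1 C2 C3 C4. represented_by I s\<^sub>0 \<kappa>\<^sub>0 \<tau> r C1 C2 C3 C4) \<and>
        (\<forall>C1 C2 C3 C4. represented_by I s\<^sub>0 \<kappa>\<^sub>0 \<tau> r C1 C2 C3 C4 \<longrightarrow>
            compatible \<kappa>\<^sub>0 C1 C2 C3)) \<and>
     (\<forall>\<tau>. smooth_on I \<tau> \<longrightarrow>
        (\<forall>C1 C2 C3 C4. compatible \<kappa>\<^sub>0 C1 C2 C3 \<longrightarrow>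
            (\<exists>r. const_curvature_curve I \<kappa>\<^sub>0 \<tau> r \<and>
                 represented_by I s\<^sub>0 \<kappa>\<^sub>0 \<tau> r C1 C2 C3 C4))) \<and>
     (\<forall>C1 C2 C3 s. compatible \<kappa>\<^sub>0 C1 C2 C3 \<longrightarrow> 0 \<le> radius_sq_formula \<kappa>\<^sub>0 C1 C2 C3 s)"
proof -
  interpret parameter_interval I using assms by unfold_locales
  show ?thesis
  proof (intro conjI allI impI)
    fix \<tau> r assume "const_curvature_curve I \<kappa>\<^sub>0 \<tau> r"
    then show "\<exists>C1 C2 C3 C4. represented_by I s\<^sub>0 \<kappa>\<^sub>0 \<tau> r C1 C2 C3 C4"
      using const_curvature_curve_represented assms(3,4) by metis
  next
    fix \<tau> r C1 C2 C3 C4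
    assume "const_curvature_curve I \<kappa>\<^sub>0 \<tau> r" "represented_by I s\<^sub>0 \<kappa>\<^sub>0 \<tau> r C1 C2 C3 C4"
    then show "compatible \<kappa>\<^sub>0 C1 C2 C3"
      using represented_by_compatible assms(3,4) by blast
  next
    fix \<tau> :: "real \<Rightarrow> real" and C1 C2 C3 C4 assume "smooth_on I \<tau>" "compatible \<kappa>\<^sub>0 C1 C2 C3"
    then show "\<exists>r. const_curvature_curve I \<kappa>\<^sub>0 \<tau> r \<and> represented_by I s\<^sub>0 \<kappa>\<^sub>0 \<tau> r C1 C2 C3 C4"
      using const_curvature_curve_exists assms(3,4) by metis
  next
    fix C1 C2 C3 s assume "compatible \<kappa>\<^sub>0 C1 C2 C3"
    then show "0 \<le> radius_sq_formula \<kappa>\<^sub>0 C1 C2 C3 s"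
      using radius_sq_formula_compatible[OF assms(4)] by simp
  qed
qed

end
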